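(* Let $G$ be a finite group that can be generated by $n$ elements, and let $\pi:H(n,G)\to G$ be any surjective homomorphism. Then for every finite group $H$ that is homogeneous of rank $n$ and every surjective homomorphism $j:H\to G$, there exists a surjective homomorphism $f:H\to H(n,G)$ such that $j=\pi\circ f$.
   Context: For a finite group $G$, $\Gamma_n(G)$ denotes the set of all sequences $(x_1,\ldots,x_n)\in G^n$ with $\langle x_1,\ldots,x_n\rangle=G$. $\operatorname{Aut}(G)$ acts on $\Gamma_n(G)$ by $f(x_1,\ldots,x_n)=(f(x_1),\ldots,f(x_n))$. A finite group $G$ is called homogeneous of rank $n$ if $\Gamma_n(G)\neq\emptyset$ and this action of $\operatorname{Aut}(G)$ on $\Gamma_n(G)$ is transitive. Let $F_n$ be the free group on $a_1,\ldots,a_n$. For $s=(x_1,\ldots,x_n)\in\Gamma_n(G)$ let $\pi_s:F_n\to G$ be the homomorphism with $\pi_s(a_i)=x_i$, and $K_s=\ker\pi_s$. If $G$ is finite and can be generated by $n$ elements, the $n$th homogeneous cover of $G$ is $H(n,G)=F_n/K$, where $K$ is the intersection of the kernels $K_s$ with $s$ running over a set of representatives of the $\operatorname{Aut}(G)$-orbits on $\Gamma_n(G)$ (equivalently, $K$ is the intersection of the kernels of all surjective homomorphisms $F_n\to G$). *)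

theory Defs
  imports "HOL-Algebra.Group_Action" "HOL-Algebra.Generated_Groups"
begin

section \<open>Free groups of finite rank\<close>

text \<open>The library has no free groups. The letter \<open>(i, True)\<close> stands for the \<open>i\<close>-th free generator
  and \<open>(i, False)\<close> for its formal inverse. Generators are numbered from \<open>0\<close>, as list positions are.\<close>

type_synonym letter = "nat \<times> bool"

definition inv_letter :: "letter \<Rightarrow> letter" where
  "inv_letter x = (fst x, \<not> snd x)"

definition reduced :: "letter list \<Rightarrow> bool" where
  "reduced w \<longleftrightarrow> successively (\<lambda>x y. y \<noteq> inv_letter x) w"

fun push :: "letter \<Rightarrow> letter list \<Rightarrow> letter list" where
  "push x [] = [x]"
| "push x (y # w) = (if y = inv_letter x then w else x # y # w)"

definition reduce :: "letter list \<Rightarrow> letter list" where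
  "reduce w = foldr push w []"

definition free_group :: "nat \<Rightarrow> letter list monoid" where
  "free_group n =
    \<lparr>carrier = {w. reduced w \<and> (\<forall>x \<in> set w. fst x < n)},
     mult = (\<lambda>u v. reduce (u @ v)),
     one = []\<rparr>"

definition free_gen :: "nat \<Rightarrow> letter list" where
  "free_gen i = [(i, True)]"

text \<open>The homomorphism from the free group with \<open>a\<^sub>i \<mapsto> s ! i\<close>; this characterization and
  uniqueness are proved below.\<close>

definition free_lift :: "('a, 'b) monoid_scheme \<Rightarrow> 'a list \<Rightarrow> letter list \<Rightarrow> 'a" where
  "free_lift G s w =
    foldr (\<lambda>x g. (if snd x then s ! fst x else inv\<^bsub>G\<^esub> (s ! fst x)) \<otimes>\<^bsub>G\<^esub> g) w \<one>\<^bsub>G\<^esub>"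


section \<open>Generating sequences and homogeneous groups\<close>

definition gen_seqs :: "nat \<Rightarrow> ('a, 'b) monoid_scheme \<Rightarrow> 'a list set" where
  "gen_seqs n G = {s. length s = n \<and> set s \<subseteq> carrier G \<and> generate G (set s) = carrier G}"

text \<open>The restriction to \<open>gen_seqs n G\<close> is needed because the library's group actions consist of
  extensional functions.\<close>

definition aut_act :: "nat \<Rightarrow> ('a, 'b) monoid_scheme \<Rightarrow> ('a \<Rightarrow> 'a) \<Rightarrow> 'a list \<Rightarrow> 'a list" where
  "aut_act n G f = (\<lambda>s \<in> gen_seqs n G. map f s)"

definition homogeneous_of_rank :: "nat \<Rightarrow> ('a, 'b) monoid_scheme \<Rightarrow> bool" where
  "homogeneous_of_rank n G \<longleftrightarrow>
    group G \<and> finite (carrier G) \<and> gen_seqs n G \<noteq> {} \<and>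
    transitive_action (AutoGroup G) (gen_seqs n G) (aut_act n G)"


section \<open>The homogeneous cover\<close>

definition orbit_reps :: "nat \<Rightarrow> ('a, 'b) monoid_scheme \<Rightarrow> 'a list set \<Rightarrow> bool" where
  "orbit_reps n G R \<longleftrightarrow>
    R \<subseteq> gen_seqs n G \<and>
    (\<forall>A \<in> orbits (AutoGroup G) (gen_seqs n G) (aut_act n G). \<exists>!s. s \<in> A \<inter> R)"

definition seq_kernel :: "nat \<Rightarrow> ('a, 'b) monoid_scheme \<Rightarrow> 'a list \<Rightarrow> letter list set" where
  "seq_kernel n G s = kernel (free_group n) G (free_lift G s)"

text \<open>The choice of the representatives is immaterial: see \<open>orbit_reps_exist\<close>,
  \<open>cover_kernel_orbit_reps\<close> and \<open>cover_kernel_epi\<close> below.\<close>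

definition cover_kernel :: "nat \<Rightarrow> ('a, 'b) monoid_scheme \<Rightarrow> letter list set" where
  "cover_kernel n G = (\<Inter>s \<in> (SOME R. orbit_reps n G R). seq_kernel n G s)"

definition homogeneous_cover :: "nat \<Rightarrow> ('a, 'b) monoid_scheme \<Rightarrow> letter list set monoid" where
  "homogeneous_cover n G = free_group n Mod cover_kernel n G"


section \<open>Well-definedness\<close>

lemma inv_letter_simps [simp]:
  "inv_letter (inv_letter x) = x" "inv_letter x \<noteq> x" "x \<noteq> inv_letter x"
  "fst (inv_letter x) = fst x" "snd (inv_letter x) = (\<not> snd x)"
  by (auto simp: inv_letter_def prod_eq_iff)

lemma reduced_simps [simp]:
  "reduced []" "reduced [x]"
  "reduced (x # y # w) \<longleftrightarrow> y \<noteq> inv_letter x \<and> reduced (y # w)"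
  by (auto simp: reduced_def)

lemma reduced_ConsD: "reduced (x # w) \<Longrightarrow> reduced w"
  by (cases w) auto

lemma reduced_push: "reduced w \<Longrightarrow> reduced (push x w)"
  by (cases w) (auto dest: reduced_ConsD)

lemma set_push: "set (push x w) \<subseteq> insert x (set w)"
  by (cases w) auto

lemma push_inv: "reduced w \<Longrightarrow> push (inv_letter x) (push x w) = w"
  by (cases w; cases "tl w") auto

lemma push_inv': "reduced w \<Longrightarrow> push x (push (inv_letter x) w) = w"
  using push_inv[of w "inv_letter x"] by simp

lemma reduced_foldr_push: "reduced v \<Longrightarrow> reduced (foldr push u v)"
  by (induction u) (auto intro: reduced_push)

lemma set_foldr_push: "set (foldr push u v) \<subseteq> set u \<union> set v"
proof (induction u)
  case (Cons x u)
  then show ?case using set_push[of x "foldr push u v"] by auto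
qed auto

lemma foldr_push_reduced: "reduced u \<Longrightarrow> foldr push u [] = u"
proof (induction u)
  case (Cons x u)
  then have "foldr push u [] = u" by (auto dest: reduced_ConsD)
  then show ?case using Cons.prems by (cases u) auto
qed auto

lemma foldr_push_push:
  assumes "reduced w"
  shows "foldr push (push x v) w = push x (foldr push v w)"
proof (cases v)
  case (Cons y v')
  have "push x (push (inv_letter x) (foldr push v' w)) = foldr push v' w"
    by (intro push_inv' reduced_foldr_push assms)
  then show ?thesis using Cons by auto
qed auto

lemma foldr_push_assoc:
  assumes "reduced w"
  shows "foldr push (foldr push u v) w = foldr push u (foldr push v w)"
  by (induction u) (auto simp: foldr_push_push assms)

lemma free_group_mult:
  assumes "reduced v"
  shows "u \<otimes>\<^bsub>free_group n\<^esub> v = foldr push u v"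
  using assms by (simp add: free_group_def reduce_def foldr_push_reduced)

lemma carrier_free_group:
  "w \<in> carrier (free_group n) \<longleftrightarrow> reduced w \<and> (\<forall>x \<in> set w. fst x < n)"
  by (simp add: free_group_def)

lemma one_free_group [simp]: "\<one>\<^bsub>free_group n\<^esub> = []"
  by (simp add: free_group_def)

lemma free_group_mult_closed:
  assumes "u \<in> carrier (free_group n)" "v \<in> carrier (free_group n)"
  shows "u \<otimes>\<^bsub>free_group n\<^esub> v \<in> carrier (free_group n)"
  using assms set_foldr_push[of u v]
  by (force simp: carrier_free_group free_group_mult reduced_foldr_push)

lemma foldr_push_inverse:
  assumes "reduced w"
  shows "foldr push (map inv_letter (rev u)) (foldr push u w) = w"
  using assms
proof (induction u arbitrary: w)
  case (Cons x u)
  then show ?case by (simp add: push_inv reduced_foldr_push)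
qed auto

theorem group_free_group: "group (free_group n)"
proof (rule groupI)
  fix u v w
  assume "u \<in> carrier (free_group n)" "v \<in> carrier (free_group n)" "w \<in> carrier (free_group n)"
  then have "reduced v" "reduced w" by (auto simp: carrier_free_group)
  then show "u \<otimes>\<^bsub>free_group n\<^esub> v \<otimes>\<^bsub>free_group n\<^esub> w = u \<otimes>\<^bsub>free_group n\<^esub> (v \<otimes>\<^bsub>free_group n\<^esub> w)"
    by (simp add: free_group_mult reduced_foldr_push foldr_push_assoc)
next
  fix u
  assume u: "u \<in> carrier (free_group n)"
  define v where "v = foldr push (map inv_letter (rev u)) []"
  have "v \<in> carrier (free_group n)"
    using u set_foldr_push[of "map inv_letter (rev u)" "[]"]
    by (force simp: carrier_free_group v_def reduced_foldr_push)
  moreover have "v \<otimes>\<^bsub>free_group n\<^esub> u = \<one>\<^bsub>free_group n\<^esub>"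
  proof -
    have r: "reduced u" using u by (simp add: carrier_free_group)
    have "foldr push v u = foldr push (map inv_letter (rev u)) (foldr push [] u)"
      unfolding v_def by (rule foldr_push_assoc[OF r])
    also have "\<dots> = foldr push (map inv_letter (rev u)) (foldr push u [])"
      using r by (simp add: foldr_push_reduced)
    also have "\<dots> = []" by (rule foldr_push_inverse) simp
    finally show ?thesis using r by (simp add: free_group_mult)
  qed
  ultimately show "\<exists>v \<in> carrier (free_group n). v \<otimes>\<^bsub>free_group n\<^esub> u = \<one>\<^bsub>free_group n\<^esub>" ..
qed (auto simp: free_group_mult_closed, auto simp: carrier_free_group free_group_mult)

lemma free_gen_closed: "i < n \<Longrightarrow> free_gen i \<in> carrier (free_group n)"
  by (simp add: carrier_free_group free_gen_def)

lemma inv_free_gen: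
  assumes "i < n"
  shows "inv\<^bsub>free_group n\<^esub> (free_gen i) = [(i, False)]"
  using assms
  by (intro group.inv_equality[OF group_free_group])
     (auto simp: carrier_free_group free_gen_def free_group_mult inv_letter_def)

context group
begin

lemma free_lift_simps [simp]:
  "free_lift G s [] = \<one>"
  "free_lift G s (x # w) = (if snd x then s ! fst x else inv (s ! fst x)) \<otimes> free_lift G s w"
  by (simp_all add: free_lift_def)

lemma free_lift_closed:
  assumes "set s \<subseteq> carrier G" "\<forall>x \<in> set w. fst x < length s"
  shows "free_lift G s w \<in> carrier G"
  using assms(2)
proof (induction w)
  case (Cons x w)
  then have "s ! fst x \<in> carrier G" using assms(1) nth_mem by fastforce
  then show ?case using Cons by auto
qed auto

lemma free_lift_push:
  assumes s: "set s \<subseteq> carrier G" and w: "\<forall>y \<in> set (x # w). fst y < length s"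
  shows "free_lift G s (push x w) = free_lift G s (x # w)"
proof (cases w)
  case (Cons y v)
  have x: "s ! fst x \<in> carrier G" using w s nth_mem by fastforce
  have v: "free_lift G s v \<in> carrier G" using w Cons by (intro free_lift_closed s) auto
  show ?thesis using x v Cons by (auto simp: m_assoc[symmetric])
qed auto

lemma free_lift_foldr_push:
  assumes s: "set s \<subseteq> carrier G"
    and u: "\<forall>y \<in> set u. fst y < length s" and v: "\<forall>y \<in> set v. fst y < length s"
  shows "free_lift G s (foldr push u v) = free_lift G s u \<otimes> free_lift G s v"
  using u
proof (induction u)
  case Nil
  then show ?case using free_lift_closed[OF s v] by simp
next
  case (Cons x u)
  have "s ! fst x \<in> carrier G" using Cons.prems s nth_mem by fastforce
  moreover have "free_lift G s u \<in> carrier G" "free_lift G s v \<in> carrier G"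
    using Cons.prems v by (auto intro!: free_lift_closed[OF s])
  moreover have "free_lift G s (push x (foldr push u v)) = free_lift G s (x # foldr push u v)"
    using Cons.prems v set_foldr_push[of u v] by (intro free_lift_push s) auto
  ultimately show ?case using Cons by (auto simp: m_assoc)
qed

theorem free_lift_hom:
  assumes "set s \<subseteq> carrier G"
  shows "free_lift G s \<in> hom (free_group (length s)) G"
proof (rule homI)
  fix w
  assume "w \<in> carrier (free_group (length s))"
  then show "free_lift G s w \<in> carrier G"
    using assms by (intro free_lift_closed) (auto simp: carrier_free_group)
next
  fix u v
  assume "u \<in> carrier (free_group (length s))" "v \<in> carrier (free_group (length s))"
  then show "free_lift G s (u \<otimes>\<^bsub>free_group (length s)\<^esub> v) = free_lift G s u \<otimes> free_lift G s v"
    using assms by (simp add: free_lift_foldr_push free_group_mult carrier_free_group)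
qed

lemma free_lift_gen:
  assumes "set s \<subseteq> carrier G" "i < length s"
  shows "free_lift G s (free_gen i) = s ! i"
  using assms nth_mem by (fastforce simp: free_gen_def)

theorem free_lift_unique:
  assumes h: "h \<in> hom (free_group (length s)) G"
    and gen: "\<And>i. i < length s \<Longrightarrow> h (free_gen i) = s ! i"
    and w: "w \<in> carrier (free_group (length s))"
  shows "h w = free_lift G s w"
proof -
  interpret h: group_hom "free_group (length s)" G h
    using h group_free_group by (simp add: group_hom_def group_hom_axioms_def group_axioms)
  show ?thesis
    using w
  proof (induction w)
    case Nil
    then show ?case using h.hom_one by simp
  next
    case (Cons x w)
    let ?F = "free_group (length s)"
    have i: "fst x < length s" and w: "w \<in> carrier ?F" and x: "[x] \<in> carrier ?F"
      using Cons.prems by (auto simp: carrier_free_group dest: reduced_ConsD)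
    have "[x] \<otimes>\<^bsub>?F\<^esub> w = x # w"
      using Cons.prems w by (cases w) (auto simp: free_group_mult carrier_free_group)
    then have "h (x # w) = h [x] \<otimes> h w"
      using h.hom_mult[OF x w] by simp
    moreover have "h [x] = (if snd x then s ! fst x else inv (s ! fst x))"
    proof (cases "snd x")
      case True
      then have "[x] = free_gen (fst x)" by (simp add: free_gen_def prod_eq_iff)
      then show ?thesis using True gen[OF i] by simp
    next
      case False
      then have "[x] = inv\<^bsub>?F\<^esub> (free_gen (fst x))"
        using i by (simp add: inv_free_gen prod_eq_iff)
      then show ?thesis using False gen[OF i] h.hom_inv[OF free_gen_closed[OF i]] by simp
    qed
    ultimately show ?case using Cons.IH[OF w] by simp
  qed
qed

lemma free_lift_compose:
  assumes "group K" "f \<in> hom G K" "set s \<subseteq> carrier G" "w \<in> carrier (free_group (length s))"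
  shows "free_lift K (map f s) w = f (free_lift G s w)"
proof -
  have "f \<circ> free_lift G s \<in> hom (free_group (length s)) K"
    using Group.hom_compose[OF free_lift_hom[OF assms(3)] assms(2)] .
  then have "(f \<circ> free_lift G s) w = free_lift K (map f s) w"
    using assms free_lift_gen
    by (intro group.free_lift_unique[OF assms(1)]) (auto simp: comp_def)
  then show ?thesis by simp
qed

lemma gen_seqs_auto:
  assumes f: "f \<in> auto G" and s: "s \<in> gen_seqs n G"
  shows "map f s \<in> gen_seqs n G"
proof -
  have hom: "f \<in> hom G G" and img: "f ` carrier G = carrier G"
    using f by (auto simp: auto_def Bij_def bij_betw_def)
  interpret f: group_hom G G f
    using hom by (simp add: group_hom_def group_hom_axioms_def group_axioms)
  have "generate G (f ` set s) = f ` generate G (set s)"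
    using f.generate_img[of "set s"] s by (auto simp: gen_seqs_def)
  then show ?thesis using s img hom by (auto simp: gen_seqs_def hom_def)
qed

lemma carrier_AutoGroup [simp]: "carrier (AutoGroup G) = auto G"
  by (simp add: AutoGroup_def)

theorem aut_act_group_action: "group_action (AutoGroup G) (gen_seqs n G) (aut_act n G)"
proof -
  let ?E = "gen_seqs n G"
  have closed: "map f s \<in> ?E" if "f \<in> auto G" "s \<in> ?E" for f s
    using that gen_seqs_auto by blast
  have bij: "aut_act n G f \<in> Bij ?E" if f: "f \<in> auto G" for f
  proof -
    let ?g = "\<lambda>x \<in> carrier G. inv_into (carrier G) f x"
    have b: "bij_betw f (carrier G) (carrier G)" using f by (simp add: auto_def Bij_def)
    have g: "?g \<in> auto G"
      using f by (auto simp: auto_def restrict_inv_into_hom restrict_inv_into_Bij)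
    have gf: "map ?g (map f s) = s" and fg: "map f (map ?g s) = s" if s: "s \<in> ?E" for s
    proof -
      have c: "x \<in> carrier G" if "x \<in> set s" for x using s that by (auto simp: gen_seqs_def)
      have "f x \<in> carrier G \<and> inv_into (carrier G) f (f x) = x \<and> f (inv_into (carrier G) f x) = x"
        if "x \<in> carrier G" for x
        using b that bij_betw_inv_into_left[OF b] bij_betw_inv_into_right[OF b]
        by (auto simp: bij_betw_def)
      then show "map ?g (map f s) = s" "map f (map ?g s) = s"
        using c by (auto intro!: map_idI simp: comp_def)
    qed
    have "bij_betw (aut_act n G f) ?E ?E"
      by (rule bij_betw_byWitness[where f' = "map ?g"])
         (use gf fg closed[OF f] closed[OF g] in \<open>auto simp: aut_act_def simp del: map_map\<close>)
    then show ?thesis by (simp add: Bij_def aut_act_def)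
  qed
  have "aut_act n G \<in> hom (AutoGroup G) (BijGroup ?E)"
  proof (rule homI)
    fix f g
    assume "f \<in> carrier (AutoGroup G)" "g \<in> carrier (AutoGroup G)"
    then have f: "f \<in> auto G" and g: "g \<in> auto G" by simp_all
    then have fg: "f \<otimes>\<^bsub>AutoGroup G\<^esub> g = compose (carrier G) f g"
      by (simp add: AutoGroup_def BijGroup_def auto_def)
    have "aut_act n G (compose (carrier G) f g) = compose ?E (aut_act n G f) (aut_act n G g)"
    proof
      fix s
      have "map (compose (carrier G) f g) s = map f (map g s)" if "s \<in> ?E"
        using that by (auto simp: gen_seqs_def compose_def)
      then show "aut_act n G (compose (carrier G) f g) s =
          compose ?E (aut_act n G f) (aut_act n G g) s"
        using closed[OF g] by (auto simp: aut_act_def compose_def simp del: map_map)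
    qed
    then show "aut_act n G (f \<otimes>\<^bsub>AutoGroup G\<^esub> g) =
        aut_act n G f \<otimes>\<^bsub>BijGroup ?E\<^esub> aut_act n G g"
      using bij[OF f] bij[OF g] fg by (simp add: BijGroup_def)
  qed (simp add: bij BijGroup_def)
  then show ?thesis
    by (simp add: group_action_def group_hom_def group_hom_axioms_def AutoGroup group_BijGroup)
qed

lemma seq_kernel_auto:
  assumes f: "f \<in> auto G" and s: "s \<in> gen_seqs n G"
  shows "seq_kernel n G (map f s) = seq_kernel n G s"
proof -
  have hom: "f \<in> hom G G" and inj: "inj_on f (carrier G)"
    using f by (auto simp: auto_def Bij_def bij_betw_def)
  have len: "length s = n" and c: "set s \<subseteq> carrier G" using s by (auto simp: gen_seqs_def)
  have "free_lift G (map f s) w = \<one> \<longleftrightarrow> free_lift G s w = \<one>" if w: "w \<in> carrier (free_group n)" for w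
  proof -
    have "free_lift G s w \<in> carrier G" using w c len by (auto intro: free_lift_closed simp: carrier_free_group)
    moreover have "f \<one> = \<one>" using hom_one[OF hom] group_axioms by blast
    ultimately have "f (free_lift G s w) = \<one> \<longleftrightarrow> free_lift G s w = \<one>"
      using inj by (metis inj_on_eq_iff one_closed)
    then show ?thesis using free_lift_compose[OF group_axioms hom c, of w] w len by simp
  qed
  then show ?thesis by (auto simp: seq_kernel_def kernel_def)
qed

theorem orbit_reps_exist: "\<exists>R. orbit_reps n G R"
proof -
  interpret act: group_action "AutoGroup G" "gen_seqs n G" "aut_act n G"
    by (rule aut_act_group_action)
  let ?O = "orbits (AutoGroup G) (gen_seqs n G) (aut_act n G)"
  define c where "c A = (SOME s. s \<in> A)" for A :: "'a list set"
  have sub: "A \<subseteq> gen_seqs n G" if "A \<in> ?O" for A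
    using that act.orbits_coverture by blast
  have c: "c A \<in> A" if A: "A \<in> ?O" for A
  proof -
    obtain s where "s \<in> gen_seqs n G" "A = orbit (AutoGroup G) (aut_act n G) s"
      using A by (auto simp: orbits_def)
    then have "s \<in> A" using act.orbit_refl by simp
    then show ?thesis unfolding c_def by (rule someI)
  qed
  have "\<exists>!s. s \<in> A \<inter> c ` ?O" if A: "A \<in> ?O" for A
  proof (rule ex1I[of _ "c A"])
    fix s
    assume "s \<in> A \<inter> c ` ?O"
    then obtain B where B: "B \<in> ?O" "s = c B" "s \<in> A" by blast
    then have "A = B" using act.disjoint_union[OF A B(1)] c[OF B(1)] by blast
    then show "s = c A" using B by simp
  qed (use A c in auto)
  then have "orbit_reps n G (c ` ?O)"
    using sub c by (auto simp: orbit_reps_def)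
  then show ?thesis ..
qed

lemma orbit_reps_INT:
  assumes "orbit_reps n G R"
  shows "(\<Inter>s \<in> R. seq_kernel n G s) = (\<Inter>s \<in> gen_seqs n G. seq_kernel n G s)"
proof
  show "(\<Inter>s \<in> gen_seqs n G. seq_kernel n G s) \<subseteq> (\<Inter>s \<in> R. seq_kernel n G s)"
    using assms unfolding orbit_reps_def by blast
  have "(\<Inter>s \<in> R. seq_kernel n G s) \<subseteq> seq_kernel n G s" if s: "s \<in> gen_seqs n G" for s
  proof -
    have "orbit (AutoGroup G) (aut_act n G) s
        \<in> orbits (AutoGroup G) (gen_seqs n G) (aut_act n G)"
      using s by (auto simp: orbits_def)
    then obtain t where t: "t \<in> R" "t \<in> orbit (AutoGroup G) (aut_act n G) s"
      using assms unfolding orbit_reps_def by blast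
    then obtain f where "f \<in> auto G" "t = map f s"
      using s by (auto simp: orbit_def aut_act_def)
    then show ?thesis
      using seq_kernel_auto[OF _ s] t(1) by blast
  qed
  then show "(\<Inter>s \<in> R. seq_kernel n G s) \<subseteq> (\<Inter>s \<in> gen_seqs n G. seq_kernel n G s)"
    by blast
qed

theorem cover_kernel_orbit_reps:
  assumes "orbit_reps n G R"
  shows "cover_kernel n G = (\<Inter>s \<in> R. seq_kernel n G s)"
  using orbit_reps_INT[OF assms] orbit_reps_INT[OF someI_ex[OF orbit_reps_exist]]
  unfolding cover_kernel_def by simp

lemma free_lift_image_generate:
  assumes "set s \<subseteq> carrier G"
  shows "free_lift G s ` carrier (free_group (length s)) = generate G (set s)"
proof
  interpret l: group_hom "free_group (length s)" G "free_lift G s"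
    using free_lift_hom[OF assms] group_free_group
    by (simp add: group_hom_def group_hom_axioms_def group_axioms)
  have "set s \<subseteq> free_lift G s ` carrier (free_group (length s))"
    using free_lift_gen[OF assms] free_gen_closed by (metis image_eqI in_set_conv_nth subsetI)
  then show "generate G (set s) \<subseteq> free_lift G s ` carrier (free_group (length s))"
    using generate_subgroup_incl l.img_is_subgroup by blast
  have "free_lift G s w \<in> generate G (set s)" if "\<forall>x \<in> set w. fst x < length s" for w
    using that by (induction w) (auto intro!: generate.eng intro: generate.intros)
  then show "free_lift G s ` carrier (free_group (length s)) \<subseteq> generate G (set s)"
    by (auto simp: carrier_free_group)
qed

theorem cover_kernel_epi:
  "cover_kernel n G = (\<Inter>h \<in> epi (free_group n) G. kernel (free_group n) G h)"
proof -
  obtain R where R: "orbit_reps n G R" using orbit_reps_exist by blast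
  have lift: "free_lift G s \<in> epi (free_group n) G" if "s \<in> gen_seqs n G" for s
    using that free_lift_hom[of s] free_lift_image_generate[of s]
    by (auto simp: gen_seqs_def epi_def)
  have seq: "\<exists>s \<in> gen_seqs n G. kernel (free_group n) G h = seq_kernel n G s"
    if h: "h \<in> epi (free_group n) G" for h
  proof -
    define s where "s = map (h \<circ> free_gen) [0..<n]"
    have len: "length s = n" by (simp add: s_def)
    have hh: "h \<in> hom (free_group n) G" "h ` carrier (free_group n) = carrier G"
      using h by (auto simp: epi_def)
    have sub: "set s \<subseteq> carrier G"
      using hh free_gen_closed by (auto simp: s_def hom_def)
    have eq: "h w = free_lift G s w" if "w \<in> carrier (free_group n)" for w
      using free_lift_unique[of h s w] hh(1) that by (simp add: s_def)
    have "h ` carrier (free_group n) = free_lift G s ` carrier (free_group n)"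
      using eq by (intro image_cong) auto
    then have "generate G (set s) = carrier G"
      using free_lift_image_generate[OF sub] hh(2) len by simp
    then have "s \<in> gen_seqs n G" using len sub by (simp add: gen_seqs_def)
    moreover have "kernel (free_group n) G h = seq_kernel n G s"
      using eq by (auto simp: seq_kernel_def kernel_def)
    ultimately show ?thesis by blast
  qed
  have "cover_kernel n G = (\<Inter>s \<in> gen_seqs n G. seq_kernel n G s)"
    using cover_kernel_orbit_reps[OF R] orbit_reps_INT[OF R] by simp
  also have "\<dots> = (\<Inter>h \<in> epi (free_group n) G. kernel (free_group n) G h)"
    using lift seq unfolding seq_kernel_def by (intro equalityI) (blast, blast)
  finally show ?thesis .
qed

end

end

theory Submission
  imports Defs
begin

text \<open>
  The group \<open>H\<close> is a quotient of the free group \<open>F\<close> of rank \<open>n\<close>: a generating sequence \<open>t\<close> of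
  \<open>H\<close> gives an epimorphism \<open>\<pi>\<^sub>t : F \<rightarrow> H\<close>. Homogeneity says that any two generating
  sequences differ by an automorphism of \<open>H\<close>, so all the epimorphisms \<open>\<pi>\<^sub>t\<close> have one and
  the same kernel \<open>N\<close>. The freedom to choose \<open>t\<close> without moving \<open>N\<close> is what makes the
  theorem work, and Gaschuetz's lemma (\<open>gaschuetz_lifting\<close>) supplies the choices: along an
  epimorphism from a finite group that is generated by \<open>n\<close> elements, every generating sequence
  of length \<open>n\<close> of the image lifts to a generating sequence of the source. It is used twice.

  First, \<open>N\<close> lies in the kernel \<open>K\<close> that defines the cover
  (\<open>homogeneous_epi_kernel_subset_cover_kernel\<close>). Indeed, \<open>K\<close> is the intersection of the
  kernels of all epimorphisms \<open>h : F \<rightarrow> G\<close>, and if \<open>u\<close> is a generating lift to \<open>H\<close>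
  of the images of the free generators under \<open>h\<close>, then \<open>h = j \<circ> \<pi>\<^sub>u\<close>, which vanishes on
  \<open>N = ker \<pi>\<^sub>u\<close>.

  Secondly, with \<open>q : F \<rightarrow> F/K\<close> the quotient map, the composite \<open>\<pi> \<circ> q\<close> is an
  epimorphism onto \<open>G\<close>, and the same lifting gives \<open>t\<close> with \<open>j \<circ> \<pi>\<^sub>t = \<pi> \<circ> q\<close>.
  As \<open>ker \<pi>\<^sub>t = N \<subseteq> K\<close>, the map \<open>q\<close> factors as \<open>f \<circ> \<pi>\<^sub>t\<close>, and then
  \<open>j \<circ> \<pi>\<^sub>t = \<pi> \<circ> f \<circ> \<pi>\<^sub>t\<close>, whence \<open>j = \<pi> \<circ> f\<close>.
\<close>

section \<open>Lifting generating sequences\<close>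

context group_hom
begin

text \<open>The sequences are sorted by the subgroup \<open>U\<close> that they generate, which need not be all of
  \<open>G\<close>: the counting argument below classifies all lifts of \<open>s\<close> by this subgroup.\<close>

definition generating_lifts :: "'a set \<Rightarrow> 'c list \<Rightarrow> 'a list set" where
  "generating_lifts U s = {t. set t \<subseteq> carrier G \<and> generate G (set t) = U \<and> map h t = s}"

lemma card_fibre_subgroup:
  assumes U: "subgroup U G" and x: "x \<in> h ` U"
  shows "card {u \<in> U. h u = x} = card {u \<in> U. h u = \<one>\<^bsub>H\<^esub>}"
proof -
  interpret U: subgroup U G by (rule U)
  obtain a where a: "a \<in> U" "x = h a"
    using x by blast
  have "bij_betw (\<lambda>u. u \<otimes> inv a) {u \<in> U. h u = x} {u \<in> U. h u = \<one>\<^bsub>H\<^esub>}"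
    by (rule bij_betw_byWitness[where f' = "\<lambda>u. u \<otimes> a"])
       (use a in \<open>auto simp: G.m_assoc U.mem_carrier\<close>)
  then show ?thesis
    by (rule bij_betw_same_card)
qed

text \<open>The entries can be lifted independently of each other, and the fibres of \<open>h\<close> in \<open>U\<close> are
  translates of one another. What matters is that the number of lifts depends on \<open>s\<close> only through
  its length.\<close>

lemma card_lifts_subgroup:
  assumes U: "subgroup U G" and s: "set s \<subseteq> h ` U"
  shows "card {t. set t \<subseteq> U \<and> map h t = s} = card {u \<in> U. h u = \<one>\<^bsub>H\<^esub>} ^ length s"
  using s
proof (induction s)
  case Nil
  have "{t. set t \<subseteq> U \<and> map h t = []} = {[]}"
    by auto
  then show ?case
    by simp
next
  case (Cons x s)
  let ?A = "{u \<in> U. h u = x}" and ?T = "{t. set t \<subseteq> U \<and> map h t = s}"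
  have "{t. set t \<subseteq> U \<and> map h t = x # s} = (\<lambda>(u, t). u # t) ` (?A \<times> ?T)"
    by (auto simp: map_eq_Cons_conv image_iff)
  moreover have "inj_on (\<lambda>(u, t). u # t) (?A \<times> ?T)"
    by (auto simp: inj_on_def)
  ultimately have "card {t. set t \<subseteq> U \<and> map h t = x # s} = card ?A * card ?T"
    by (simp add: card_image card_cartesian_product)
  then show ?case
    using Cons card_fibre_subgroup[OF U, of x] by simp
qed

text \<open>This is the core of Gaschuetz's lemma: the number of lifts that generate \<open>U\<close> is the same for
  all generating sequences of \<open>H\<close> of a given length. All lifts in \<open>U\<close> are equinumerous for \<open>s\<close> and
  \<open>s'\<close>, and each of them generates a subgroup \<open>V\<close> of \<open>U\<close> that still maps onto \<open>H\<close>.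
  By induction the proper subgroups account for equally many lifts of \<open>s\<close> and of \<open>s'\<close>, so the
  same number is left over for \<open>U\<close> itself.\<close>

lemma card_generating_lifts_eq:
  assumes fin: "finite (carrier G)" and U: "subgroup U G" and hU: "h ` U = carrier H"
    and s: "s \<in> gen_seqs n H" and s': "s' \<in> gen_seqs n H"
  shows "card (generating_lifts U s) = card (generating_lifts U s')"
  using U hU
proof (induction "card U" arbitrary: U rule: less_induct)
  case less
  interpret U: subgroup U G by (rule less.prems)
  have finU: "finite U"
    using fin U.subset finite_subset by blast
  define L where "L r = {t. set t \<subseteq> U \<and> map h t = r}" for r
  define P where "P = {V. subgroup V G \<and> V \<subset> U \<and> h ` V = carrier H}"
  have finP: "finite P"
    by (rule finite_subset[of _ "Pow U"]) (use finU in \<open>auto simp: P_def\<close>)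
  have split: "card (L r) = (\<Sum>V \<in> P. card (generating_lifts V r)) + card (generating_lifts U r)"
    if r: "r \<in> gen_seqs n H" for r
  proof -
    have finL: "finite (L r)"
      by (rule finite_subset[OF _ finite_lists_length_eq[OF finU, of "length r"]])
         (auto simp: L_def)
    have "L r = (\<Union>V \<in> insert U P. generating_lifts V r)"
    proof (intro equalityI subsetI)
      fix t
      assume t: "t \<in> L r"
      let ?V = "generate G (set t)"
      have tU: "set t \<subseteq> U" and tr: "map h t = r"
        using t by (auto simp: L_def)
      then have tG: "set t \<subseteq> carrier G"
        using U.subset by blast
      have "h ` ?V = generate H (set r)"
        using generate_img[OF tG] tr by (metis image_set)
      then have "h ` ?V = carrier H"
        using r by (simp add: gen_seqs_def)
      moreover have "?V \<subseteq> U"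
        by (rule G.generate_subgroup_incl[OF tU less.prems(1)])
      moreover have "subgroup ?V G"
        by (rule G.generate_is_subgroup[OF tG])
      ultimately have "?V \<in> insert U P"
        by (auto simp: P_def)
      then show "t \<in> (\<Union>V \<in> insert U P. generating_lifts V r)"
        using tG tr by (auto simp: generating_lifts_def)
    next
      fix t
      assume "t \<in> (\<Union>V \<in> insert U P. generating_lifts V r)"
      then show "t \<in> L r"
        using generate.incl[of _ "set t" G] by (auto simp: generating_lifts_def P_def L_def)
    qed
    moreover have "card (\<Union>V \<in> insert U P. generating_lifts V r)
        = (\<Sum>V \<in> insert U P. card (generating_lifts V r))"
    proof (rule card_UN_disjoint)
      show "\<forall>V \<in> insert U P. finite (generating_lifts V r)"
        using finL calculation by (metis UN_upper finite_subset)
    qed (use finP in \<open>auto simp: generating_lifts_def\<close>)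
    ultimately show ?thesis
      using finP by (simp add: P_def)
  qed
  have "card (generating_lifts V s) = card (generating_lifts V s')" if "V \<in> P" for V
    using that less.hyps finU by (auto simp: P_def psubset_card_mono)
  then have "(\<Sum>V \<in> P. card (generating_lifts V s)) = (\<Sum>V \<in> P. card (generating_lifts V s'))"
    by (rule sum.cong[OF refl])
  moreover have "card (L s) = card (L s')"
    using card_lifts_subgroup[OF less.prems(1)] s s' less.prems(2)
    by (simp add: L_def gen_seqs_def)
  ultimately show ?case
    using split[OF s] split[OF s'] by simp
qed

text \<open>The image of a generating sequence of \<open>G\<close> has at least one generating lift, and the number of
  these lifts does not depend on the sequence of \<open>H\<close> that is lifted.\<close>

theorem gaschuetz_lifting:
  assumes fin: "finite (carrier G)" and surj: "h ` carrier G = carrier H"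
    and ne: "gen_seqs n G \<noteq> {}" and s: "s \<in> gen_seqs n H"
  shows "\<exists>t \<in> gen_seqs n G. map h t = s"
proof -
  obtain t\<^sub>0 where t\<^sub>0: "t\<^sub>0 \<in> gen_seqs n G"
    using ne by blast
  then have c: "set t\<^sub>0 \<subseteq> carrier G"
    by (simp add: gen_seqs_def)
  have "generate H (h ` set t\<^sub>0) = carrier H"
    using generate_img[OF c] t\<^sub>0 surj by (simp add: gen_seqs_def)
  then have s\<^sub>0: "map h t\<^sub>0 \<in> gen_seqs n H"
    using t\<^sub>0 c by (auto simp: gen_seqs_def)
  let ?L = "generating_lifts (carrier G)"
  have "finite (?L (map h t\<^sub>0))"
    by (rule finite_subset[OF _ finite_lists_length_eq[OF fin, of "length t\<^sub>0"]])
       (auto simp: generating_lifts_def dest: map_eq_imp_length_eq)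
  moreover have "t\<^sub>0 \<in> ?L (map h t\<^sub>0)"
    using t\<^sub>0 by (simp add: generating_lifts_def gen_seqs_def)
  ultimately have "card (?L (map h t\<^sub>0)) \<noteq> 0"
    by auto
  then have "card (?L s) \<noteq> 0"
    using card_generating_lifts_eq[OF fin G.subgroup_self surj s s\<^sub>0] by simp
  then obtain t where "t \<in> ?L s"
    by fastforce
  then show ?thesis
    using s by (auto simp: generating_lifts_def gen_seqs_def)
qed

end

section \<open>Factoring epimorphisms\<close>

lemma epi_factor:
  assumes p: "group_hom F H p" "p \<in> epi F H" and q: "group_hom F C q" "q \<in> epi F C"
    and ker: "kernel F H p \<subseteq> kernel F C q"
  shows "\<exists>f \<in> epi H C. \<forall>w \<in> carrier F. f (p w) = q w"
proof -
  interpret p: group_hom F H p by (rule p)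
  interpret q: group_hom F C q by (rule q)
  have pim: "p ` carrier F = carrier H" and qim: "q ` carrier F = carrier C"
    using p(2) q(2) by (auto simp: epi_def)
  define f where "f = q \<circ> inv_into (carrier F) p"
  have f: "f (p w) = q w" if w: "w \<in> carrier F" for w
  proof -
    define v where "v = inv_into (carrier F) p (p w)"
    have v: "v \<in> carrier F" "p v = p w"
      using w by (auto simp: v_def inv_into_into f_inv_into_f)
    then have "v \<otimes>\<^bsub>F\<^esub> inv\<^bsub>F\<^esub> w \<in> kernel F H p"
      using w by (simp add: kernel_def)
    then have "v \<otimes>\<^bsub>F\<^esub> inv\<^bsub>F\<^esub> w \<in> kernel F C q"
      using ker by blast
    then have "q v \<otimes>\<^bsub>C\<^esub> inv\<^bsub>C\<^esub> q w = \<one>\<^bsub>C\<^esub>"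
      using v w by (simp add: kernel_def)
    then have "q v = q w"
      using v w q.H.inv_equality[of "q v" "inv\<^bsub>C\<^esub> q w"] by simp
    then show ?thesis
      by (simp add: f_def v_def)
  qed
  have "f \<in> hom H C"
  proof (rule homI)
    fix x assume "x \<in> carrier H"
    then show "f x \<in> carrier C"
      unfolding pim[symmetric] using f by auto
  next
    fix x y assume "x \<in> carrier H" "y \<in> carrier H"
    then obtain v w where "v \<in> carrier F" "w \<in> carrier F" "x = p v" "y = p w"
      unfolding pim[symmetric] by blast
    then show "f (x \<otimes>\<^bsub>H\<^esub> y) = f x \<otimes>\<^bsub>C\<^esub> f y"
      using f by (metis p.G.m_closed p.hom_mult q.hom_mult)
  qed
  moreover have "f ` carrier H = carrier C"
    unfolding pim[symmetric] qim[symmetric] image_image using f by auto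
  ultimately show ?thesis
    using f by (auto simp: epi_def)
qed

section \<open>Homogeneous groups and the homogeneous cover\<close>

text \<open>An automorphism that carries \<open>s\<close> to \<open>t\<close> also carries \<open>\<pi>\<^sub>s\<close> to \<open>\<pi>\<^sub>t\<close>.\<close>

lemma homogeneous_seq_kernel_eq:
  assumes "homogeneous_of_rank n H" "s \<in> gen_seqs n H" "t \<in> gen_seqs n H"
  shows "seq_kernel n H s = seq_kernel n H t"
proof -
  interpret group H
    using assms(1) by (simp add: homogeneous_of_rank_def)
  interpret act: transitive_action "AutoGroup H" "gen_seqs n H" "aut_act n H"
    using assms(1) by (simp add: homogeneous_of_rank_def)
  obtain f where "f \<in> auto H" "t = map f s"
    using act.unique_orbit[OF assms(2,3)] assms(2) by (auto simp: aut_act_def)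
  then show ?thesis
    using seq_kernel_auto[OF _ assms(2)] by simp
qed

context group
begin

lemma free_lift_epi:
  assumes "s \<in> gen_seqs n G"
  shows "free_lift G s \<in> epi (free_group n) G"
  using assms free_lift_hom[of s] free_lift_image_generate[of s]
  by (auto simp: gen_seqs_def epi_def)

text \<open>Epimorphisms from the free group correspond to generating sequences; this is the passage from the
  former to the latter, in the form needed to apply the lifting theorem to an epimorphism.\<close>

lemma epi_free_gens:
  assumes "h \<in> epi (free_group n) G"
  shows "map (h \<circ> free_gen) [0..<n] \<in> gen_seqs n G"
    and "\<And>w. w \<in> carrier (free_group n) \<Longrightarrow> free_lift G (map (h \<circ> free_gen) [0..<n]) w = h w"
proof -
  let ?s = "map (h \<circ> free_gen) [0..<n]"
  have hom: "h \<in> hom (free_group n) G" and im: "h ` carrier (free_group n) = carrier G"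
    using assms by (auto simp: epi_def)
  have sub: "set ?s \<subseteq> carrier G"
    using hom free_gen_closed by (auto simp: hom_def)
  show eq: "free_lift G ?s w = h w" if "w \<in> carrier (free_group n)" for w
    using free_lift_unique[of h ?s w] hom that by simp
  have "generate G (set ?s) = h ` carrier (free_group n)"
    using free_lift_image_generate[OF sub] eq by simp
  then show "?s \<in> gen_seqs n G"
    using sub im by (simp add: gen_seqs_def)
qed

text \<open>Without generating sequences of length \<open>n\<close> the intersection would run over the empty family
  and be the whole type, which is not a subgroup.\<close>

lemma cover_kernel_normal:
  assumes "gen_seqs n G \<noteq> {}"
  shows "cover_kernel n G \<lhd> free_group n"
proof -
  interpret F: group "free_group n" by (rule group_free_group)
  have ne: "epi (free_group n) G \<noteq> {}"
    using assms free_lift_epi by blast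
  have nrm: "kernel (free_group n) G h \<lhd> free_group n" if "h \<in> epi (free_group n) G" for h
    using that group_free_group group_axioms
    by (intro group_hom.normal_kernel) (auto simp: group_hom_def group_hom_axioms_def epi_def)
  have "subgroup (\<Inter> (kernel (free_group n) G ` epi (free_group n) G)) (free_group n)"
    using ne nrm by (intro F.subgroups_Inter) (auto simp: normal_def)
  then show ?thesis
    using nrm unfolding cover_kernel_epi F.normal_inv_iff by blast
qed

end

text \<open>An epimorphism \<open>h\<close> from the free group onto \<open>G\<close> lifts through \<open>j\<close> to some
  \<open>\<pi>\<^sub>u\<close>, by lifting the images of the generators. So \<open>h\<close> kills \<open>ker \<pi>\<^sub>u\<close>, which by
  homogeneity is the kernel of \<open>\<pi>\<^sub>t\<close>.\<close>

theorem homogeneous_epi_kernel_subset_cover_kernel: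
  assumes G: "group G" and H: "homogeneous_of_rank n H" and j: "j \<in> epi H G"
    and t: "t \<in> gen_seqs n H"
  shows "seq_kernel n H t \<subseteq> cover_kernel n G"
proof -
  interpret G: group G by (rule G)
  interpret H: group H using H by (simp add: homogeneous_of_rank_def)
  interpret j: group_hom H G j
    using j by unfold_locales (auto simp: epi_def)
  have "w \<in> kernel (free_group n) G h"
    if w: "w \<in> seq_kernel n H t" and h: "h \<in> epi (free_group n) G" for w h
  proof -
    let ?s = "map (h \<circ> free_gen) [0..<n]"
    obtain u where u: "u \<in> gen_seqs n H" "map j u = ?s"
      using j.gaschuetz_lifting[OF _ _ _ G.epi_free_gens(1)[OF h]] H j
      by (auto simp: homogeneous_of_rank_def epi_def)
    have wu: "w \<in> seq_kernel n H u"
      using w homogeneous_seq_kernel_eq[OF H t u(1)] by simp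
    then have wF: "w \<in> carrier (free_group n)" and w1: "free_lift H u w = \<one>\<^bsub>H\<^esub>"
      by (auto simp: seq_kernel_def kernel_def)
    have "h w = free_lift G (map j u) w"
      using G.epi_free_gens(2)[OF h wF] u(2) by simp
    also have "\<dots> = j (free_lift H u w)"
      using u(1) wF by (intro H.free_lift_compose[OF G j.homh]) (auto simp: gen_seqs_def)
    finally show ?thesis
      using wF w1 by (simp add: kernel_def)
  qed
  then show ?thesis
    unfolding G.cover_kernel_epi by blast
qed

theorem proposition5p2:
  fixes G :: "('a, 'b) monoid_scheme" and H :: "('c, 'd) monoid_scheme"
    and n :: nat and \<pi> :: "letter list set \<Rightarrow> 'a" and j :: "'c \<Rightarrow> 'a"
  assumes "group G" and "finite (carrier G)" and "gen_seqs n G \<noteq> {}"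
    and "\<pi> \<in> epi (homogeneous_cover n G) G"
    and "homogeneous_of_rank n H"
    and "j \<in> epi H G"
  shows "\<exists>f \<in> epi H (homogeneous_cover n G). \<forall>x \<in> carrier H. j x = (\<pi> \<circ> f) x"
proof -
  interpret G: group G by (rule assms(1))
  interpret H: group H using assms(5) by (simp add: homogeneous_of_rank_def)
  interpret j: group_hom H G j
    using assms(6) by unfold_locales (auto simp: epi_def)
  interpret F: group "free_group n" by (rule group_free_group)
  let ?F = "free_group n" and ?K = "cover_kernel n G" and ?C = "homogeneous_cover n G"
  interpret K: normal ?K ?F
    by (rule G.cover_kernel_normal[OF assms(3)])
  interpret C: group ?C
    unfolding homogeneous_cover_def by (rule K.factorgroup_is_group)
  define q where "q w = ?K #>\<^bsub>?F\<^esub> w" for w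
  have q_hom: "q \<in> hom ?F ?C"
    using K.r_coset_hom_Mod unfolding q_def homogeneous_cover_def .
  have q_epi: "q \<in> epi ?F ?C"
    using q_hom by (auto simp: epi_def q_def homogeneous_cover_def FactGroup_def RCOSETS_def)
  interpret q: group_hom ?F ?C q
    using q_hom by unfold_locales
  have ker_q: "?K \<subseteq> kernel ?F ?C q"
    using K.subset F.coset_join2[OF _ K.is_subgroup]
    by (auto simp: kernel_def q_def homogeneous_cover_def FactGroup_def)

  define h where "h = \<pi> \<circ> q"
  have "h ` carrier ?F = \<pi> ` q ` carrier ?F"
    by (simp only: h_def image_comp)
  then have h: "h \<in> epi ?F G"
    using q_epi assms(4) Group.hom_compose[of q ?F ?C \<pi> G]
    by (simp add: epi_def h_def)
  \<comment> \<open>A lift of \<open>\<pi> \<circ> q\<close> through \<open>j\<close>: this particular \<open>t\<close> makes the triangle commute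
    with the given \<open>\<pi>\<close>.\<close>
  obtain t where t: "t \<in> gen_seqs n H" "map j t = map (h \<circ> free_gen) [0..<n]"
    using j.gaschuetz_lifting[OF _ _ _ G.epi_free_gens(1)[OF h]] assms(5,6)
    by (auto simp: homogeneous_of_rank_def epi_def)
  let ?p = "free_lift H t"
  have p_epi: "?p \<in> epi ?F H"
    by (rule H.free_lift_epi[OF t(1)])
  interpret p: group_hom ?F H ?p
    using p_epi by unfold_locales (simp add: epi_def)
  have "kernel ?F H ?p \<subseteq> kernel ?F ?C q"
    using homogeneous_epi_kernel_subset_cover_kernel[OF assms(1,5,6) t(1)] ker_q
    by (simp add: seq_kernel_def)
  then obtain f where f: "f \<in> epi H ?C" and fp: "\<And>w. w \<in> carrier ?F \<Longrightarrow> f (?p w) = q w"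
    using epi_factor[OF p.group_hom_axioms p_epi q.group_hom_axioms q_epi] by blast
  have "j x = (\<pi> \<circ> f) x" if x: "x \<in> carrier H" for x
  proof -
    obtain w where w: "w \<in> carrier ?F" "x = ?p w"
      using x p_epi by (auto simp: epi_def)
    have "j x = free_lift G (map j t) w"
      using t(1) w
      by (auto simp: gen_seqs_def intro!: H.free_lift_compose[OF assms(1) j.homh, symmetric])
    also have "\<dots> = \<pi> (q w)"
      using G.epi_free_gens(2)[OF h w(1)] t(2) by (simp add: h_def)
    finally show ?thesis
      using fp w by simp
  qed
  then show ?thesis
    using f by blast
qed

end
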